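(* Thomas division, Janet division, Pommaret division, Division I, Division II, and, for every admissible monomial ordering $\succ$, the induced division $D_\succ$, are all pairwise involutive divisions.
   Context: $\mathbb{M}=\{x_1^{d_1}\cdots x_n^{d_n}\mid d_i\in\mathbb{Z}_{\ge 0}\}$, and $\deg_i(u)$ is the degree of $x_i$ in $u$. Each division $L$ below is specified by a partition of $\{x_1,\dots,x_n\}$ into multiplicative variables $M_L(u,U)$ and nonmultiplicative variables $NM_L(u,U)$ for each finite $U\subset\mathbb{M}$ and $u\in U$; $L(u,U)$ is the submonoid of $\mathbb{M}$ generated by $M_L(u,U)$. All of them are known to be involutive divisions, i.e. they satisfy: (a) if $w\in L(u,U)$ and $v\mid w$, then $v\in L(u,U)$; (b) if $u,v\in U$ and $uL(u,U)\cap vL(v,U)\neq\emptyset$, then $u\in vL(v,U)$ or $v\in uL(u,U)$; (c) if $v\in U$ and $v\in uL(u,U)$, then $L(v,U)\subseteq L(u,U)$; (d) if $V\subseteq U$, then $L(u,U)\subseteq L(u,V)$ for all $u\in V$. Pairwise: an involutive division $L$ is pairwise if for any finite set $U\subset\mathbb{M}$ and any $u\in U$ with $U\setminus\{u\}\ne\emptyset$ one has $L(u,U)=\bigcap_{v\in U\setminus\{u\}}L(u,\{u,v\})$ or, equivalently, $M_L(u,U)=\bigcap_{v\in U\setminus\{u\}}M_L(u,\{u,v\})$ and $NM_L(u,U)=\bigcup_{v\in U\setminus\{u\}}NM_L(u,\{u,v\})$. Thomas division: $x_i$ is multiplicative for $u\in U$ iff $\deg_i(u)=\max\{\deg_i(v)\mid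 v\in U\}$. Janet division: for $1\le i\le n$ and non-negative integers $d_1,\dots,d_i$ let $[d_1,\dots,d_i]=\{u\in U\mid d_j=\deg_j(u),\ 1\le j\le i\}$. The variable $x_i$ is multiplicative for $u\in U$ iff either $i=1$ and $\deg_1(u)=\max\{\deg_1(v)\mid v\in U\}$, or $i>1$, $u\in[d_1,\dots,d_{i-1}]$ and $\deg_i(u)=\max\{\deg_i(v)\mid v\in[d_1,\dots,d_{i-1}]\}$. Pommaret division: for $u=x_1^{d_1}\cdots x_k^{d_k}$ with $d_k>0$ the variables $x_j$, $j\ge k$, are multiplicative and the others nonmultiplicative; for $u=1$ all variables are multiplicative. Division I: $x_i$ is nonmultiplicative for $u\in U$ iff there is $v\in U$ such that $x_{i_1}^{d_1}\cdots x_{i_m}^{d_m}u=\mathrm{lcm}(u,v)$ with distinct indices $i_1,\dots,i_m$, $1\le m\le[n/2]$ (integer part), $d_j>0$ for $1\le j\le m$, and $x_i\in\{x_{i_1},\dots,x_{i_m}\}$. Division II: for $u=x_1^{d_1}\cdots x_n^{d_n}$ the variable $x_i$ is multiplicative iff $d_i=\max\{d_1,\dots,d_n\}$. Induced division $D_\succ$: $x_i$ is nonmultiplicative for $u\in U$ iff there is $v\in U$ with $v\prec u$ and $\deg_i(u)<\deg_i(v)$. An admissible monomial ordering is a total ordering on $\mathbb{M}$, compatible with multiplication, in which $1$ is the smallest element. *)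

theory Defs
  imports "HOL-Library.Multiset"
begin

text \<open>
  The monoid of monomials in \<open>x\<^sub>1, \<dots>, x\<^sub>n\<close> is the free commutative monoid on the indices
  \<open>1, \<dots>, n\<close>, so a monomial is a multiset of indices: the product of monomials is \<open>+\<close>,
  the monomial \<open>1\<close> is \<open>{#}\<close>, \<open>x\<^sub>i\<close> is \<open>{#i#}\<close>, divisibility is \<open>\<subseteq>#\<close> and the least common
  multiple is \<open>\<union>#\<close>.  Variables are represented by their indices.
\<close>

type_synonym monomial = "nat multiset"

definition monomials :: "nat \<Rightarrow> monomial set" where
  "monomials n = {u. set_mset u \<subseteq> {1..n}}"

abbreviation deg :: "nat \<Rightarrow> monomial \<Rightarrow> nat" where
  "deg i u \<equiv> count u i"

text \<open>
  A division is given by its set of multiplicative variables \<open>M u U\<close>; the nonmultiplicative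
  variables are \<open>{1..n} - M u U\<close>.  Only the values for finite \<open>U \<subseteq> monomials n\<close> and \<open>u \<in> U\<close> matter.
\<close>

type_synonym division = "monomial \<Rightarrow> monomial set \<Rightarrow> nat set"

inductive_set submonoid_generated :: "monomial set \<Rightarrow> monomial set" for X where
  one: "{#} \<in> submonoid_generated X"
| incl: "u \<in> X \<Longrightarrow> u \<in> submonoid_generated X"
| mult: "u \<in> submonoid_generated X \<Longrightarrow> v \<in> submonoid_generated X \<Longrightarrow> u + v \<in> submonoid_generated X"

definition mult_monoid :: "division \<Rightarrow> monomial \<Rightarrow> monomial set \<Rightarrow> monomial set" where
  "mult_monoid M u U = submonoid_generated ((\<lambda>i. {#i#}) ` M u U)"

text \<open>The set \<open>u L(u,U)\<close>.\<close>

definition involutive_cone :: "division \<Rightarrow> monomial \<Rightarrow> monomial set \<Rightarrow> monomial set" where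
  "involutive_cone M u U = (\<lambda>w. u + w) ` mult_monoid M u U"

definition involutive_division :: "nat \<Rightarrow> division \<Rightarrow> bool" where
  "involutive_division n M \<longleftrightarrow>
    (\<forall>U. finite U \<and> U \<subseteq> monomials n \<longrightarrow>
      (\<forall>u\<in>U. M u U \<subseteq> {1..n}) \<and>
      (\<forall>u\<in>U. \<forall>w\<in>mult_monoid M u U. \<forall>v\<in>monomials n. v \<subseteq># w \<longrightarrow> v \<in> mult_monoid M u U) \<and>
      (\<forall>u\<in>U. \<forall>v\<in>U. involutive_cone M u U \<inter> involutive_cone M v U \<noteq> {} \<longrightarrow>
        u \<in> involutive_cone M v U \<or> v \<in> involutive_cone M u U) \<and>
      (\<forall>u\<in>U. \<forall>v\<in>U. v \<in> involutive_cone M u U \<longrightarrow> mult_monoid M v U \<subseteq> mult_monoid M u U) \<and>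
      (\<forall>V. V \<subseteq> U \<longrightarrow> (\<forall>u\<in>V. mult_monoid M u U \<subseteq> mult_monoid M u V)))"

definition pairwise_involutive_division :: "nat \<Rightarrow> division \<Rightarrow> bool" where
  "pairwise_involutive_division n M \<longleftrightarrow>
    involutive_division n M \<and>
    (\<forall>U u. finite U \<and> U \<subseteq> monomials n \<and> u \<in> U \<and> U - {u} \<noteq> {} \<longrightarrow>
      mult_monoid M u U = (\<Inter>v\<in>U - {u}. mult_monoid M u {u, v}))"

definition thomas_division :: "nat \<Rightarrow> division" where
  "thomas_division n u U = {i \<in> {1..n}. deg i u = Max (deg i ` U)}"

text \<open>The set \<open>[d\<^sub>1, \<dots>, d\<^sub>i]\<close>; only the values \<open>d 1, \<dots>, d i\<close> of \<open>d\<close> are used.\<close>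

definition janet_group :: "monomial set \<Rightarrow> nat \<Rightarrow> (nat \<Rightarrow> nat) \<Rightarrow> monomial set" where
  "janet_group U i d = {u \<in> U. \<forall>j\<in>{1..i}. d j = deg j u}"

definition janet_division :: "nat \<Rightarrow> division" where
  "janet_division n u U =
    {i \<in> {1..n}.
      (i = 1 \<and> deg 1 u = Max (deg 1 ` U)) \<or>
      (i > 1 \<and> (\<exists>d. u \<in> janet_group U (i - 1) d \<and>
        deg i u = Max (deg i ` janet_group U (i - 1) d)))}"

definition pommaret_division :: "nat \<Rightarrow> division" where
  "pommaret_division n u U = (if u = {#} then {1..n} else {Max (set_mset u)..n})"

text \<open>The set \<open>I\<close> below is \<open>{i\<^sub>1, \<dots>, i\<^sub>m}\<close>.\<close>

definition division_I :: "nat \<Rightarrow> division" where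
  "division_I n u U = {1..n} -
    {i. \<exists>v\<in>U. \<exists>I d. I \<subseteq> {1..n} \<and> 1 \<le> card I \<and> card I \<le> n div 2 \<and> (\<forall>j\<in>I. d j > 0) \<and>
      (\<Sum>j\<in>I. replicate_mset (d j) j) + u = u \<union># v \<and> i \<in> I}"

definition division_II :: "nat \<Rightarrow> division" where
  "division_II n u U = {i \<in> {1..n}. deg i u = Max ((\<lambda>j. deg j u) ` {1..n})}"

text \<open>Here \<open>prec\<close> is the strict order, \<open>prec v u\<close> meaning \<open>v \<prec> u\<close>.\<close>

definition admissible_ordering :: "nat \<Rightarrow> (monomial \<Rightarrow> monomial \<Rightarrow> bool) \<Rightarrow> bool" where
  "admissible_ordering n prec \<longleftrightarrow>
    irreflp_on (monomials n) prec \<and> transp_on (monomials n) prec \<and> totalp_on (monomials n) prec \<and>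
    (\<forall>u\<in>monomials n. \<forall>v\<in>monomials n. \<forall>w\<in>monomials n. prec u v \<longrightarrow> prec (u + w) (v + w)) \<and>
    (\<forall>u\<in>monomials n. u \<noteq> {#} \<longrightarrow> prec {#} u)"

definition induced_division :: "nat \<Rightarrow> (monomial \<Rightarrow> monomial \<Rightarrow> bool) \<Rightarrow> division" where
  "induced_division n prec u U = {1..n} - {i. \<exists>v\<in>U. prec v u \<and> deg i u < deg i v}"

end

theory Submission
  imports Defs
begin

text \<open>
  In all six divisions, whether \<open>x\<^sub>i\<close> is multiplicative for \<open>u \<in> U\<close> is decided by testing \<open>u\<close>
  against one element \<open>v\<close> of \<open>U\<close> at a time: \<open>M u U = {i \<in> {1..n}. \<forall>v\<in>U. P u v i}\<close> for a suitable
  relation \<open>P\<close>.  Such a set is antitone in \<open>U\<close>, and the universal quantifier splits over the pairs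
  \<open>{u, v}\<close>; hence axiom (d) and the pairwise property hold for every \<open>P\<close>.

  What is left concerns \<open>P\<close> alone.  A product \<open>u w\<close> lies in the cone \<open>u L(u,U)\<close> iff every variable
  whose degree has grown is multiplicative for \<open>u\<close>.  So two cones meet only if the least common
  multiple of their generators lies in both, and (b) becomes: if \<open>u\<close> and \<open>v\<close> both admit all the
  variables needed to reach their least common multiple, one of them divides the other.  For (c),
  let \<open>v\<close> be in the cone of \<open>u\<close>.  The variables that occur in \<open>v / u\<close> are multiplicative for \<open>u\<close>
  anyway, so only variables of equal degree in \<open>u\<close> and \<open>v\<close> have to be compared.  These two
  conditions are the hypotheses of \<open>pairwise_involutive_divisionI\<close>.

  The first condition holds for the following reasons.  For the Thomas and Janet divisions,
  distinct monomials always block each other, in the Janet case at the first variable where they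
  differ, so their cones are disjoint.  A Pommaret cone extends \<open>u\<close> only at or after its last
  variable, so if \<open>u\<close> and \<open>v\<close> end at the same variable they differ only there, and otherwise the one
  that ends first divides the other.  In Division I, a strict excess on either side must involve
  more than half of the variables, so it cannot occur on both sides.  In Division II, excesses on
  both sides would make each of the two maximal degrees smaller than the other.  In an induced
  division, the larger of two monomials may not grow towards the smaller one, so unless it is a
  multiple of the smaller one the cones are disjoint.

  For the second condition, let \<open>v\<close> be in the cone of \<open>u\<close>, with the same degree in \<open>x\<^sub>i\<close>.  If some
  \<open>w \<in> U\<close> blocks \<open>x\<^sub>i\<close> for \<open>u\<close>, it must block \<open>x\<^sub>i\<close> for \<open>v\<close>.  For Thomas and Janet \<open>u = v\<close>.  For
  Pommaret and Division II the block comes from \<open>u\<close> itself, through a later variable or a larger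
  exponent, and persists in the multiple \<open>v\<close>.  In Division I, passing from \<open>u\<close> to \<open>v\<close> only removes
  variables from those in which \<open>w\<close> is in excess, and in an induced division \<open>w \<prec> u\<close> gives \<open>w \<prec> v\<close>,
  because divisors precede their multiples.
\<close>

section \<open>Cones and a criterion for pairwise involutive divisions\<close>

lemma submonoid_generated_variables:
  "submonoid_generated ((\<lambda>i. {#i#}) ` A) = {w. set_mset w \<subseteq> A}"
proof (intro set_eqI iffI)
  fix w assume "w \<in> submonoid_generated ((\<lambda>i. {#i#}) ` A)"
  then show "w \<in> {w. set_mset w \<subseteq> A}"
    by induction auto
next
  fix w assume "w \<in> {w. set_mset w \<subseteq> A}"
  then have "set_mset w \<subseteq> A" by simp
  then show "w \<in> submonoid_generated ((\<lambda>i. {#i#}) ` A)"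
  proof (induction w)
    case empty
    show ?case by (rule submonoid_generated.one)
  next
    case (add i w)
    then have "{#i#} + w \<in> submonoid_generated ((\<lambda>i. {#i#}) ` A)"
      by (intro submonoid_generated.mult) (auto intro: submonoid_generated.incl)
    then show ?case by simp
  qed
qed

lemma mult_monoid_eq: "mult_monoid M u U = {w. set_mset w \<subseteq> M u U}"
  by (simp add: mult_monoid_def submonoid_generated_variables)

lemma mult_monoid_mono: "M u U \<subseteq> M' v V \<Longrightarrow> mult_monoid M u U \<subseteq> mult_monoid M' v V"
  by (auto simp: mult_monoid_eq)

lemma involutive_cone_iff:
  "x \<in> involutive_cone M u U \<longleftrightarrow> u \<subseteq># x \<and> (\<forall>i. deg i u < deg i x \<longrightarrow> i \<in> M u U)"
proof
  assume "x \<in> involutive_cone M u U"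
  then obtain w where "x = u + w" "set_mset w \<subseteq> M u U"
    by (auto simp: involutive_cone_def mult_monoid_eq)
  then show "u \<subseteq># x \<and> (\<forall>i. deg i u < deg i x \<longrightarrow> i \<in> M u U)"
    by auto
next
  assume x: "u \<subseteq># x \<and> (\<forall>i. deg i u < deg i x \<longrightarrow> i \<in> M u U)"
  then have "x = u + (x - u)" "set_mset (x - u) \<subseteq> M u U"
    by (auto simp: in_diff_count)
  then show "x \<in> involutive_cone M u U"
    unfolding involutive_cone_def mult_monoid_eq by blast
qed

lemma not_dvd_iff: "\<not> u \<subseteq># v \<longleftrightarrow> (\<exists>i. deg i v < deg i u)"
  by (simp add: subseteq_mset_def not_le)

lemma deg_eq_0_outside: "u \<in> monomials n \<Longrightarrow> i \<notin> {1..n} \<Longrightarrow> deg i u = 0"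
  by (auto simp: monomials_def not_in_iff)

lemma excess_index: "v \<in> monomials n \<Longrightarrow> deg i u < deg i v \<Longrightarrow> i \<in> {1..n}"
  using deg_eq_0_outside[of v n i] by linarith

lemma excess_variables: "v \<in> monomials n \<Longrightarrow> {j. deg j u < deg j v} \<subseteq> {1..n}"
  using excess_index by blast

text \<open>
  The relation \<open>P u v i\<close> says that \<open>v\<close> does not prevent \<open>x\<^sub>i\<close> from being multiplicative for \<open>u\<close>.
  Axioms (b) and (c) involve \<open>U\<close> only through the monomials named in \<open>comparable\<close> and \<open>nested\<close>,
  so it is enough to check them for \<open>P\<close>.
\<close>

lemma pairwise_involutive_divisionI:
  assumes char: "\<And>U u. \<lbrakk>finite U; U \<subseteq> monomials n; u \<in> U\<rbrakk> \<Longrightarrow>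
      M u U = {i \<in> {1..n}. \<forall>v\<in>U. P u v i}"
    and comparable: "\<And>u v. \<lbrakk>u \<in> monomials n; v \<in> monomials n;
      \<And>i. deg i u < deg i v \<Longrightarrow> P u v i; \<And>i. deg i v < deg i u \<Longrightarrow> P v u i\<rbrakk> \<Longrightarrow>
      u \<subseteq># v \<or> v \<subseteq># u"
    and nested: "\<And>u v w i. \<lbrakk>u \<in> monomials n; v \<in> monomials n; w \<in> monomials n; u \<subseteq># v;
      \<And>j. deg j u < deg j v \<Longrightarrow> P u v j; i \<in> {1..n}; deg i u = deg i v; P v w i\<rbrakk> \<Longrightarrow>
      P u w i"
  shows "pairwise_involutive_division n M"
  unfolding pairwise_involutive_division_def involutive_division_def
proof (intro conjI allI impI ballI)
  fix U u assume U: "finite U \<and> U \<subseteq> monomials n" and u: "u \<in> U"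
  then show "M u U \<subseteq> {1..n}" by (auto simp: char)
next
  fix U u w v assume "w \<in> mult_monoid M u U" "v \<subseteq># w"
  then show "v \<in> mult_monoid M u U"
    using set_mset_mono[of v w] by (auto simp: mult_monoid_eq)
next
  fix U u v
  assume U: "finite U \<and> U \<subseteq> monomials n" and uv: "u \<in> U" "v \<in> U"
    and "involutive_cone M u U \<inter> involutive_cone M v U \<noteq> {}"
  then obtain x where x: "x \<in> involutive_cone M u U" "x \<in> involutive_cone M v U" by blast
  then have le: "deg i u \<le> deg i x" "deg i v \<le> deg i x" for i
    by (simp_all add: involutive_cone_iff mset_subset_eq_count)
  have gu: "i \<in> M u U" if "deg i u < deg i v" for i
    using x(1) that le(2)[of i] by (simp add: involutive_cone_iff)
  have gv: "i \<in> M v U" if "deg i v < deg i u" for i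
    using x(2) that le(1)[of i] by (simp add: involutive_cone_iff)
  have "u \<subseteq># v \<or> v \<subseteq># u"
    using U uv gu gv by (intro comparable) (auto simp: char)
  then show "u \<in> involutive_cone M v U \<or> v \<in> involutive_cone M u U"
    using gu gv by (auto simp: involutive_cone_iff)
next
  fix U u v
  assume U: "finite U \<and> U \<subseteq> monomials n" and uv: "u \<in> U" "v \<in> U"
    and "v \<in> involutive_cone M u U"
  then have le: "u \<subseteq># v" and g: "\<And>i. deg i u < deg i v \<Longrightarrow> i \<in> M u U"
    by (auto simp: involutive_cone_iff)
  have "M v U \<subseteq> M u U"
  proof
    fix i assume i: "i \<in> M v U"
    show "i \<in> M u U"
    proof (cases "deg i u < deg i v")
      case True
      then show ?thesis by (rule g)
    next
      case False
      then have eq: "deg i u = deg i v"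
        using mset_subset_eq_count[OF le, of i] by simp
      have "P u w i" if "w \<in> U" for w
        by (rule nested[of u v w i]) (use U uv that le g i eq in \<open>auto simp: char\<close>)
      then show ?thesis using U uv i by (auto simp: char)
    qed
  qed
  then show "mult_monoid M v U \<subseteq> mult_monoid M u U" by (rule mult_monoid_mono)
next
  fix U V u
  assume U: "finite U \<and> U \<subseteq> monomials n" and V: "V \<subseteq> U" and u: "u \<in> V"
  have "finite V" "V \<subseteq> monomials n" using U V finite_subset by auto
  then have "M u V = {i \<in> {1..n}. \<forall>v\<in>V. P u v i}" using u by (rule char)
  then have "M u U \<subseteq> M u V" using U V u char[of U u] by auto
  then show "mult_monoid M u U \<subseteq> mult_monoid M u V" by (rule mult_monoid_mono)
next
  fix U u
  assume U: "finite U \<and> U \<subseteq> monomials n \<and> u \<in> U \<and> U - {u} \<noteq> {}"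
  then have pair: "M u {u, v} = {i \<in> {1..n}. P u u i \<and> P u v i}" if "v \<in> U - {u}" for v
    using that by (subst char) auto
  have "M u U = (\<Inter>v\<in>U - {u}. M u {u, v})"
    using U by (auto simp: char pair)
  then show "mult_monoid M u U = (\<Inter>v\<in>U - {u}. mult_monoid M u {u, v})"
    by (auto simp: mult_monoid_eq)
qed

section \<open>Thomas and Janet divisions\<close>

lemma deg_eq_Max_iff:
  "finite U \<Longrightarrow> u \<in> U \<Longrightarrow> deg i u = Max (deg i ` U) \<longleftrightarrow> (\<forall>v\<in>U. deg i v \<le> deg i u)"
  by (subst eq_commute, subst Max_eq_iff) auto

lemma pairwise_involutive_thomas:
  "pairwise_involutive_division n (thomas_division n)"
proof (rule pairwise_involutive_divisionI[where P = "\<lambda>u v i. deg i v \<le> deg i u"])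
  fix U u assume "finite U" "U \<subseteq> monomials n" "u \<in> U"
  then show "thomas_division n u U = {i \<in> {1..n}. \<forall>v\<in>U. deg i v \<le> deg i u}"
    by (simp add: thomas_division_def deg_eq_Max_iff)
next
  fix u v :: monomial assume "\<And>i. deg i u < deg i v \<Longrightarrow> deg i v \<le> deg i u"
  then have "v \<subseteq># u" unfolding subseteq_mset_def by (meson nle_le not_le)
  then show "u \<subseteq># v \<or> v \<subseteq># u" ..
qed auto

text \<open>
  The group that decides about \<open>x\<^sub>i\<close> consists of the monomials that agree with \<open>u\<close> in all earlier
  variables; for \<open>i = 1\<close> it is all of \<open>U\<close>, so both clauses of the definition have this form.
\<close>

lemma janet_division_eq:
  assumes "finite U" "u \<in> U"
  shows "janet_division n u U =
    {i \<in> {1..n}. \<forall>v\<in>U. (\<forall>j\<in>{1..<i}. deg j u = deg j v) \<longrightarrow> deg i v \<le> deg i u}"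
proof -
  define G where "G i = {v \<in> U. \<forall>j\<in>{1..<i}. deg j u = deg j v}" for i
  have G: "finite (G i)" "u \<in> G i" for i using assms by (auto simp: G_def)
  have G1: "G 1 = U" by (simp add: G_def)
  have group: "janet_group U (i - 1) d = G i" if "i > 1" "u \<in> janet_group U (i - 1) d" for i d
  proof -
    have "{1..i - 1} = {1..<i}" using \<open>i > 1\<close> by auto
    then show ?thesis using that(2) by (auto simp: janet_group_def G_def)
  qed
  have mem: "u \<in> janet_group U (i - 1) (\<lambda>j. deg j u)" for i
    using assms by (simp add: janet_group_def)
  have later: "(\<exists>d. u \<in> janet_group U (i - 1) d \<and> deg i u = Max (deg i ` janet_group U (i - 1) d))
      \<longleftrightarrow> deg i u = Max (deg i ` G i)" if "i > 1" for i
  proof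
    assume "\<exists>d. u \<in> janet_group U (i - 1) d \<and> deg i u = Max (deg i ` janet_group U (i - 1) d)"
    then show "deg i u = Max (deg i ` G i)" using group[OF that] by auto
  next
    assume "deg i u = Max (deg i ` G i)"
    then show "\<exists>d. u \<in> janet_group U (i - 1) d \<and>
        deg i u = Max (deg i ` janet_group U (i - 1) d)"
      using group[OF that mem] G(2) by (intro exI[of _ "\<lambda>j. deg j u"]) simp
  qed
  have "janet_division n u U = {i \<in> {1..n}. deg i u = Max (deg i ` G i)}"
    unfolding janet_division_def
  proof (intro Collect_cong conj_cong refl)
    fix i assume "i \<in> {1..n}"
    then consider "i = 1" | "i > 1" by fastforce
    then show "i = 1 \<and> deg 1 u = Max (deg 1 ` U) \<or>
        i > 1 \<and> (\<exists>d. u \<in> janet_group U (i - 1) d \<and>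
          deg i u = Max (deg i ` janet_group U (i - 1) d)) \<longleftrightarrow>
        deg i u = Max (deg i ` G i)"
    proof cases
      case 1
      show ?thesis unfolding 1 G1 by simp
    next
      case 2
      then show ?thesis unfolding later[OF 2] by simp
    qed
  qed
  also have "\<dots> = {i \<in> {1..n}. \<forall>v\<in>G i. deg i v \<le> deg i u}"
    using deg_eq_Max_iff[OF G] by simp
  finally show ?thesis by (auto simp: G_def)
qed

lemma first_difference:
  assumes "u \<in> monomials n" "v \<in> monomials n" "u \<noteq> v"
  obtains i where "i \<in> {1..n}" "deg i u \<noteq> deg i v" "\<forall>j\<in>{1..<i}. deg j u = deg j v"
proof -
  have "\<exists>i. deg i u \<noteq> deg i v" using assms(3) by (meson multiset_eqI)
  then have "deg (LEAST i. deg i u \<noteq> deg i v) u \<noteq> deg (LEAST i. deg i u \<noteq> deg i v) v"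
    by (rule LeastI_ex)
  moreover from this have "(LEAST i. deg i u \<noteq> deg i v) \<in> {1..n}"
    using assms(1,2) deg_eq_0_outside by metis
  moreover have "\<forall>j\<in>{1..<(LEAST i. deg i u \<noteq> deg i v)}. deg j u = deg j v"
    using not_less_Least by fastforce
  ultimately show ?thesis using that by blast
qed

lemma pairwise_involutive_janet:
  "pairwise_involutive_division n (janet_division n)"
proof (rule pairwise_involutive_divisionI[where
      P = "\<lambda>u v i. (\<forall>j\<in>{1..<i}. deg j u = deg j v) \<longrightarrow> deg i v \<le> deg i u"])
  fix U u assume "finite U" "U \<subseteq> monomials n" "u \<in> U"
  then show "janet_division n u U =
      {i \<in> {1..n}. \<forall>v\<in>U. (\<forall>j\<in>{1..<i}. deg j u = deg j v) \<longrightarrow> deg i v \<le> deg i u}"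
    by (intro janet_division_eq)
next
  fix u v
  assume m: "u \<in> monomials n" "v \<in> monomials n"
    and uv: "\<And>i. deg i u < deg i v \<Longrightarrow>
      (\<forall>j\<in>{1..<i}. deg j u = deg j v) \<longrightarrow> deg i v \<le> deg i u"
    and vu: "\<And>i. deg i v < deg i u \<Longrightarrow>
      (\<forall>j\<in>{1..<i}. deg j v = deg j u) \<longrightarrow> deg i u \<le> deg i v"
  have "u = v"
  proof (rule ccontr)
    assume "u \<noteq> v"
    then obtain i where "deg i u \<noteq> deg i v" "\<forall>j\<in>{1..<i}. deg j u = deg j v"
      using first_difference m by blast
    then show False using uv[of i] vu[of i] by (cases "deg i u < deg i v") auto
  qed
  then show "u \<subseteq># v \<or> v \<subseteq># u" by simp
next
  fix u v w i
  assume m: "u \<in> monomials n" "v \<in> monomials n" and le: "u \<subseteq># v"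
    and uv: "\<And>j. deg j u < deg j v \<Longrightarrow>
      (\<forall>k\<in>{1..<j}. deg k u = deg k v) \<longrightarrow> deg j v \<le> deg j u"
    and vw: "(\<forall>j\<in>{1..<i}. deg j v = deg j w) \<longrightarrow> deg i w \<le> deg i v"
  have "u = v"
  proof (rule ccontr)
    assume "u \<noteq> v"
    then obtain j where "deg j u \<noteq> deg j v" "\<forall>k\<in>{1..<j}. deg k u = deg k v"
      using first_difference m by blast
    then show False using uv[of j] mset_subset_eq_count[OF le, of j] by auto
  qed
  then show "(\<forall>j\<in>{1..<i}. deg j u = deg j w) \<longrightarrow> deg i w \<le> deg i u" using vw by simp
qed

section \<open>Pommaret division\<close>

lemma pommaret_division_eq:
  assumes "u \<in> monomials n"
  shows "pommaret_division n u U = {i \<in> {1..n}. \<forall>k\<in>#u. k \<le> i}"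
proof (cases "u = {#}")
  case True
  then show ?thesis by (auto simp: pommaret_division_def)
next
  case False
  then have "Max (set_mset u) \<in># u" by simp
  then have "Max (set_mset u) \<in> {1..n}"
    using assms unfolding monomials_def by blast
  then show ?thesis using False by (force simp: pommaret_division_def)
qed

lemma pairwise_involutive_pommaret:
  "pairwise_involutive_division n (pommaret_division n)"
proof (rule pairwise_involutive_divisionI[where P = "\<lambda>u v i. \<forall>k\<in>#u. k \<le> i"])
  fix U u assume "U \<subseteq> monomials n" "u \<in> U"
  then show "pommaret_division n u U = {i \<in> {1..n}. \<forall>v\<in>U. \<forall>k\<in>#u. k \<le> i}"
    by (subst pommaret_division_eq) auto
next
  fix u v :: monomial
  assume uv: "\<And>i. deg i u < deg i v \<Longrightarrow> \<forall>k\<in>#u. k \<le> i"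
    and vu: "\<And>i. deg i v < deg i u \<Longrightarrow> \<forall>k\<in>#v. k \<le> i"
  show "u \<subseteq># v \<or> v \<subseteq># u"
  proof (rule ccontr)
    assume "\<not> ?thesis"
    then obtain i j where "deg i u < deg i v" "deg j v < deg j u"
      unfolding de_Morgan_disj not_dvd_iff by blast
    moreover from this have "i \<in># v" "j \<in># u" by (auto intro: count_inI)
    \<comment> \<open>An excess on either side sits at or beyond the last variable of the other monomial.\<close>
    ultimately have "i = j" using uv[of i] vu[of j] by force
    then show False using \<open>deg i u < deg i v\<close> \<open>deg j v < deg j u\<close> by simp
  qed
next
  fix u v :: monomial and i assume le: "u \<subseteq># v" and "\<forall>k\<in>#v. k \<le> i"
  then show "\<forall>k\<in>#u. k \<le> i" using set_mset_mono[OF le] by blast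
qed

section \<open>Divisions I and II\<close>

text \<open>
  A product of positive powers of variables that turns \<open>u\<close> into \<open>lcm(u,v)\<close> is unique: its
  variables are those in which \<open>v\<close> exceeds \<open>u\<close>, and the exponents are the excesses.
\<close>

lemma division_I_eq:
  assumes U: "U \<subseteq> monomials n"
  shows "division_I n u U =
    {i \<in> {1..n}. \<forall>v\<in>U. deg i u < deg i v \<longrightarrow> n div 2 < card {j. deg j u < deg j v}}"
proof -
  have "(\<exists>I d. I \<subseteq> {1..n} \<and> 1 \<le> card I \<and> card I \<le> n div 2 \<and> (\<forall>j\<in>I. d j > 0) \<and>
      (\<Sum>j\<in>I. replicate_mset (d j) j) + u = u \<union># v \<and> i \<in> I) \<longleftrightarrow>
      deg i u < deg i v \<and> card {j. deg j u < deg j v} \<le> n div 2"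
    (is "?L \<longleftrightarrow> ?R") if "v \<in> U" for v i
  proof
    assume ?L
    then obtain I d where I: "I \<subseteq> {1..n}" "card I \<le> n div 2" "\<forall>j\<in>I. d j > 0" "i \<in> I"
      and eq: "(\<Sum>j\<in>I. replicate_mset (d j) j) + u = u \<union># v" by blast
    have fin: "finite I" using I(1) finite_subset by blast
    have cnt: "(if j \<in> I then d j else 0) + deg j u = max (deg j u) (deg j v)" for j
      using arg_cong[OF eq, of "deg j"] fin by (simp add: count_sum)
    have "j \<in> I \<longleftrightarrow> deg j u < deg j v" for j
      using cnt[of j] I(3) by (auto simp: max_def split: if_splits)
    then have "I = {j. deg j u < deg j v}" by blast
    then show ?R using I by auto
  next
    assume R: ?R
    let ?I = "{j. deg j u < deg j v}" and ?d = "\<lambda>j. deg j v - deg j u"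
    have sub: "?I \<subseteq> {1..n}" using U that by (intro excess_variables) auto
    then have fin: "finite ?I" using finite_subset by blast
    then have "card ?I \<ge> 1" using R by (metis (mono_tags, lifting) One_nat_def Suc_leI
          card_gt_0_iff empty_iff mem_Collect_eq)
    moreover have "(\<Sum>j\<in>?I. replicate_mset (?d j) j) + u = u \<union># v"
      using fin by (intro multiset_eqI) (auto simp: count_sum max_def)
    ultimately show ?L using sub R by (intro exI[of _ ?I] exI[of _ ?d]) auto
  qed
  then show ?thesis unfolding division_I_def by (auto simp: not_le)
qed

lemma pairwise_involutive_division_I:
  "pairwise_involutive_division n (division_I n)"
proof (rule pairwise_involutive_divisionI[where
      P = "\<lambda>u v i. deg i u < deg i v \<longrightarrow> n div 2 < card {j. deg j u < deg j v}"])
  fix U u assume "U \<subseteq> monomials n"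
  then show "division_I n u U =
      {i \<in> {1..n}. \<forall>v\<in>U. deg i u < deg i v \<longrightarrow> n div 2 < card {j. deg j u < deg j v}}"
    by (rule division_I_eq)
next
  fix u v
  assume m: "u \<in> monomials n" "v \<in> monomials n"
    and uv: "\<And>i. deg i u < deg i v \<Longrightarrow> deg i u < deg i v \<longrightarrow>
      n div 2 < card {j. deg j u < deg j v}"
    and vu: "\<And>i. deg i v < deg i u \<Longrightarrow> deg i v < deg i u \<longrightarrow>
      n div 2 < card {j. deg j v < deg j u}"
  let ?A = "{j. deg j u < deg j v}" and ?B = "{j. deg j v < deg j u}"
  show "u \<subseteq># v \<or> v \<subseteq># u"
  proof (rule ccontr)
    assume "\<not> ?thesis"
    then obtain i j where "deg i u < deg i v" "deg j v < deg j u"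
      unfolding de_Morgan_disj not_dvd_iff by blast
    then have "n div 2 < card ?A" "n div 2 < card ?B" using uv vu by blast+
    moreover have sub: "?A \<subseteq> {1..n}" "?B \<subseteq> {1..n}"
      by (rule excess_variables, rule m)+
    moreover from sub have "card ?A + card ?B = card (?A \<union> ?B)"
      by (intro card_Un_disjoint[symmetric]) (auto intro: finite_subset)
    moreover from sub have "card (?A \<union> ?B) \<le> n"
      using card_mono[of "{1..n}" "?A \<union> ?B"] by simp
    ultimately show False by linarith
  qed
next
  fix u v w i
  assume w: "w \<in> monomials n" and le: "u \<subseteq># v" and eq: "deg i u = deg i v"
    and vw: "deg i v < deg i w \<longrightarrow> n div 2 < card {j. deg j v < deg j w}"
  have "{j. deg j u < deg j w} \<subseteq> {1..n}" using w by (rule excess_variables)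
  moreover have "{j. deg j v < deg j w} \<subseteq> {j. deg j u < deg j w}"
    using mset_subset_eq_count[OF le] le_less_trans by blast
  ultimately have "card {j. deg j v < deg j w} \<le> card {j. deg j u < deg j w}"
    by (meson card_mono finite_atLeastAtMost finite_subset)
  then show "deg i u < deg i w \<longrightarrow> n div 2 < card {j. deg j u < deg j w}"
    using vw eq by auto
qed

lemma division_II_eq: "division_II n u U = {i \<in> {1..n}. \<forall>j\<in>{1..n}. deg j u \<le> deg i u}"
proof -
  have "deg i u = Max ((\<lambda>j. deg j u) ` {1..n}) \<longleftrightarrow> (\<forall>j\<in>{1..n}. deg j u \<le> deg i u)"
    if "i \<in> {1..n}" for i
    using that by (subst eq_commute, subst Max_eq_iff) auto
  then show ?thesis by (auto simp: division_II_def)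
qed

lemma pairwise_involutive_division_II:
  "pairwise_involutive_division n (division_II n)"
proof (rule pairwise_involutive_divisionI[where P = "\<lambda>u v i. \<forall>j\<in>{1..n}. deg j u \<le> deg i u"])
  fix U :: "monomial set" and u assume "u \<in> U"
  then show "division_II n u U = {i \<in> {1..n}. \<forall>v\<in>U. \<forall>j\<in>{1..n}. deg j u \<le> deg i u}"
    by (auto simp: division_II_eq)
next
  fix u v
  assume m: "u \<in> monomials n" "v \<in> monomials n"
    and uv: "\<And>i. deg i u < deg i v \<Longrightarrow> \<forall>j\<in>{1..n}. deg j u \<le> deg i u"
    and vu: "\<And>i. deg i v < deg i u \<Longrightarrow> \<forall>j\<in>{1..n}. deg j v \<le> deg i v"
  show "u \<subseteq># v \<or> v \<subseteq># u"
  proof (rule ccontr)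
    assume "\<not> ?thesis"
    then obtain i j where ij: "deg i u < deg i v" "deg j v < deg j u"
      unfolding de_Morgan_disj not_dvd_iff by blast
    then have "i \<in> {1..n}" "j \<in> {1..n}"
      using excess_index m by blast+
    then have "deg j u \<le> deg i u" "deg i v \<le> deg j v" using uv[OF ij(1)] vu[OF ij(2)] by auto
    then show False using ij by linarith
  qed
next
  fix u v :: monomial and i
  assume "u \<subseteq># v" "deg i u = deg i v" "\<forall>j\<in>{1..n}. deg j v \<le> deg i v"
  then show "\<forall>j\<in>{1..n}. deg j u \<le> deg i u"
    by (metis mset_subset_eq_count order_trans)
qed

section \<open>Divisions induced by admissible orderings\<close>

text \<open>Multiply \<open>1 \<prec> v / u\<close> by \<open>u\<close>.\<close>

lemma admissible_ordering_dvd: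
  assumes adm: "admissible_ordering n prec" and m: "u \<in> monomials n" "v \<in> monomials n"
    and le: "u \<subseteq># v" and ne: "u \<noteq> v"
  shows "prec u v"
proof -
  have "v - u \<in> monomials n" using m(2) by (auto simp: monomials_def dest: in_diffD)
  moreover have "v - u \<noteq> {#}" using le ne by (metis add.right_neutral subset_mset.add_diff_inverse)
  moreover have "{#} \<in> monomials n" by (simp add: monomials_def)
  ultimately have "prec ({#} + u) (v - u + u)"
    using adm m(1) unfolding admissible_ordering_def by blast
  then show ?thesis using le by simp
qed

lemma pairwise_involutive_induced:
  assumes adm: "admissible_ordering n prec"
  shows "pairwise_involutive_division n (induced_division n prec)"
proof (rule pairwise_involutive_divisionI[where
      P = "\<lambda>u v i. prec v u \<longrightarrow> deg i v \<le> deg i u"])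
  fix U u
  show "induced_division n prec u U =
      {i \<in> {1..n}. \<forall>v\<in>U. prec v u \<longrightarrow> deg i v \<le> deg i u}"
    by (auto simp: induced_division_def not_less)
next
  fix u v
  assume m: "u \<in> monomials n" "v \<in> monomials n"
    and uv: "\<And>i. deg i u < deg i v \<Longrightarrow> prec v u \<longrightarrow> deg i v \<le> deg i u"
    and vu: "\<And>i. deg i v < deg i u \<Longrightarrow> prec u v \<longrightarrow> deg i u \<le> deg i v"
  have "u = v \<or> prec v u \<or> prec u v"
    using adm m unfolding admissible_ordering_def totalp_on_def by blast
  then show "u \<subseteq># v \<or> v \<subseteq># u"
  proof (elim disjE)
    assume "prec v u"
    then have "v \<subseteq># u" using uv not_dvd_iff[of v u] leD by blast
    then show ?thesis ..
  next
    assume "prec u v"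
    then have "u \<subseteq># v" using vu not_dvd_iff[of u v] leD by blast
    then show ?thesis ..
  qed simp
next
  fix u v w i
  assume m: "u \<in> monomials n" "v \<in> monomials n" "w \<in> monomials n" and le: "u \<subseteq># v"
    and eq: "deg i u = deg i v" and vw: "prec w v \<longrightarrow> deg i w \<le> deg i v"
  have "prec w v" if "prec w u"
  proof (cases "u = v")
    case False
    then have "prec u v" using admissible_ordering_dvd adm m(1,2) le by blast
    then show ?thesis
      using adm m that unfolding admissible_ordering_def transp_on_def by blast
  qed (use that in simp)
  then show "prec w u \<longrightarrow> deg i w \<le> deg i u" using vw eq by simp
qed

theorem proposition4p6:
  fixes n :: nat
  shows "pairwise_involutive_division n (thomas_division n) \<and>
    pairwise_involutive_division n (janet_division n) \<and>
    pairwise_involutive_division n (pommaret_division n) \<and>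
    pairwise_involutive_division n (division_I n) \<and>
    pairwise_involutive_division n (division_II n) \<and>
    (\<forall>prec. admissible_ordering n prec \<longrightarrow>
      pairwise_involutive_division n (induced_division n prec))"
  using pairwise_involutive_thomas pairwise_involutive_janet pairwise_involutive_pommaret
    pairwise_involutive_division_I pairwise_involutive_division_II pairwise_involutive_induced
  by blast

end
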